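(* Let $V:L^2[0,1]\to L^2[0,1]$ be the Volterra operator. Then \[ W(V^{-1})=\{z\in\mathbb{C}:\operatorname{Re} z\ge 0\}. \]
   Context: $L^2[0,1]$ is the complex Hilbert space of (classes of) square-integrable complex-valued functions on $[0,1]$ with respect to Lebesgue measure, with inner product $\langle f,g\rangle=\int_0^1 f\overline{g}$. The Volterra operator is defined by $Vf(x):=\int_0^x f(t)\,dt$ for $f\in L^2[0,1]$; it is an injective bounded operator. $V^{-1}$ denotes the (unbounded) operator with domain $D(V^{-1})=V(L^2[0,1])$ inverse to $V$. For a (possibly unbounded) operator $A$ with domain $D(A)\subset H$, where $H$ is a complex Hilbert space, the numerical range of $A$ is $W(A):=\{\langle Ax,x\rangle : x\in D(A),\ \|x\|=1\}$. *)

theory Defs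
  imports "HOL-Analysis.Analysis"
begin

section \<open>Complex inner product spaces\<close>

text \<open>
  The norm is the one inherited from \<^class>\<open>real_inner\<close>, so that
  \<open>norm x = sqrt (Re (cinner x x))\<close>; positive definiteness of \<open>cinner\<close> is inherited in the same way.
  \<open>cinner\<close> is linear in its first argument.
\<close>

class complex_inner = real_inner +
  fixes scaleC :: "complex \<Rightarrow> 'a \<Rightarrow> 'a"  (infixr \<open>*\<^sub>C\<close> 75)
    and cinner :: "'a \<Rightarrow> 'a \<Rightarrow> complex"
  assumes scaleC_add_right: "c *\<^sub>C (x + y) = c *\<^sub>C x + c *\<^sub>C y"
    and scaleC_add_left: "(c + d) *\<^sub>C x = c *\<^sub>C x + d *\<^sub>C x"
    and scaleC_scaleC: "c *\<^sub>C (d *\<^sub>C x) = (c * d) *\<^sub>C x"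
    and scaleR_scaleC: "scaleR r x = complex_of_real r *\<^sub>C x"
    and cinner_commute: "cinner x y = cnj (cinner y x)"
    and cinner_add_left: "cinner (x + y) z = cinner x z + cinner y z"
    and cinner_scaleC_left: "cinner (c *\<^sub>C x) y = c * cinner x y"
    and inner_eq_Re_cinner: "inner x y = Re (cinner x y)"

text \<open>
  A possibly unbounded operator is given by its domain \<open>D\<close> and a function \<open>A\<close>
  whose values outside of \<open>D\<close> are irrelevant.
\<close>

definition numerical_range :: "'a::complex_inner set \<Rightarrow> ('a \<Rightarrow> 'a) \<Rightarrow> complex set" where
  "numerical_range D A = {cinner (A x) x |x. x \<in> D \<and> norm x = 1}"


section \<open>The space of square-integrable functions on the unit interval\<close>

abbreviation leb01 :: "real measure" where
  "leb01 \<equiv> lebesgue_on {0..1}"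

definition square_integrable01 :: "(real \<Rightarrow> complex) \<Rightarrow> bool" where
  "square_integrable01 f \<longleftrightarrow>
     f \<in> borel_measurable leb01 \<and> integrable leb01 (\<lambda>x. (norm (f x))\<^sup>2)"

definition L2_rel :: "(real \<Rightarrow> complex) \<Rightarrow> (real \<Rightarrow> complex) \<Rightarrow> bool" where
  "L2_rel f g \<longleftrightarrow>
     square_integrable01 f \<and> square_integrable01 g \<and> (AE x in leb01. f x = g x)"

lemma square_integrable01_zero: "square_integrable01 (\<lambda>_. 0)"
  by (simp add: square_integrable01_def)

lemma square_integrable01_mult:
  assumes f: "square_integrable01 f" and g: "square_integrable01 g"
  shows "integrable leb01 (\<lambda>x. f x * cnj (g x))"
proof (rule Bochner_Integration.integrable_bound)
  show "integrable leb01 (\<lambda>x. (norm (f x))\<^sup>2 + (norm (g x))\<^sup>2)"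
    using f g by (auto simp: square_integrable01_def)
  have [measurable]: "f \<in> borel_measurable leb01" "g \<in> borel_measurable leb01"
    using f g by (auto simp: square_integrable01_def)
  have "(\<lambda>x. cnj (g x)) \<in> borel_measurable leb01"
    by (rule borel_measurable_continuous_on[OF _ \<open>g \<in> borel_measurable leb01\<close>])
       (intro continuous_intros)
  then show "(\<lambda>x. f x * cnj (g x)) \<in> borel_measurable leb01"
    by measurable
  show "AE x in leb01. norm (f x * cnj (g x)) \<le> norm ((norm (f x))\<^sup>2 + (norm (g x))\<^sup>2)"
  proof (rule AE_I2)
    fix x
    have "2 * (norm (f x) * norm (g x)) \<le> (norm (f x))\<^sup>2 + (norm (g x))\<^sup>2"
      using sum_squares_bound[of "norm (f x)" "norm (g x)"] by simp
    moreover have "0 \<le> norm (f x) * norm (g x)"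
      by simp
    ultimately have "norm (f x) * norm (g x) \<le> (norm (f x))\<^sup>2 + (norm (g x))\<^sup>2"
      by linarith
    then show "norm (f x * cnj (g x)) \<le> norm ((norm (f x))\<^sup>2 + (norm (g x))\<^sup>2)"
      by (simp add: norm_mult)
  qed
qed

lemma square_integrable01_scale:
  assumes "square_integrable01 f"
  shows "square_integrable01 (\<lambda>x. c * f x)"
  using assms by (auto simp: square_integrable01_def norm_mult power_mult_distrib)

lemma square_integrable01_add:
  assumes f: "square_integrable01 f" and g: "square_integrable01 g"
  shows "square_integrable01 (\<lambda>x. f x + g x)"
proof -
  have [measurable]: "f \<in> borel_measurable leb01" "g \<in> borel_measurable leb01"
    using f g by (auto simp: square_integrable01_def)
  have "integrable leb01 (\<lambda>x. (norm (f x + g x))\<^sup>2)"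
  proof (rule Bochner_Integration.integrable_bound)
    show "integrable leb01 (\<lambda>x. 2 * (norm (f x))\<^sup>2 + 2 * (norm (g x))\<^sup>2)"
      using f g by (auto simp: square_integrable01_def)
    show "AE x in leb01. norm ((norm (f x + g x))\<^sup>2) \<le> norm (2 * (norm (f x))\<^sup>2 + 2 * (norm (g x))\<^sup>2)"
    proof (rule AE_I2)
      fix x
      have "(norm (f x + g x))\<^sup>2 \<le> (norm (f x) + norm (g x))\<^sup>2"
        by (intro power_mono norm_triangle_ineq) auto
      also have "\<dots> \<le> 2 * (norm (f x))\<^sup>2 + 2 * (norm (g x))\<^sup>2"
        using sum_squares_bound[of "norm (f x)" "norm (g x)"] by (simp add: power2_sum)
      finally show "norm ((norm (f x + g x))\<^sup>2) \<le> norm (2 * (norm (f x))\<^sup>2 + 2 * (norm (g x))\<^sup>2)"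
        by simp
    qed
  qed measurable
  then show ?thesis
    by (simp add: square_integrable01_def)
qed

lemma square_integrable01_integrable:
  assumes "square_integrable01 f"
  shows "integrable leb01 f"
proof -
  have "square_integrable01 (\<lambda>_. 1)"
    by (simp add: square_integrable01_def finite_measure_lebesgue_on finite_measure.integrable_const)
  from square_integrable01_mult[OF assms this] show ?thesis
    by simp
qed

quotient_type L2 = "real \<Rightarrow> complex" / partial: L2_rel
proof (rule part_equivpI)
  show "\<exists>f. L2_rel f f"
    using square_integrable01_zero by (auto simp: L2_rel_def)
  show "symp L2_rel"
    by (auto simp: symp_def L2_rel_def)
  show "transp L2_rel"
    unfolding transp_def L2_rel_def by (auto)
qed

instantiation L2 :: complex_inner
begin

lift_definition zero_L2 :: L2 is "\<lambda>_. 0"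
  by (simp add: L2_rel_def square_integrable01_zero)

lift_definition plus_L2 :: "L2 \<Rightarrow> L2 \<Rightarrow> L2" is "\<lambda>f g x. f x + g x"
  by (auto simp: L2_rel_def square_integrable01_add)

lift_definition scaleC_L2 :: "complex \<Rightarrow> L2 \<Rightarrow> L2" is "\<lambda>c f x. c * f x"
  by (auto simp: L2_rel_def square_integrable01_scale)

lift_definition cinner_L2 :: "L2 \<Rightarrow> L2 \<Rightarrow> complex" is
  "\<lambda>f g. integral\<^sup>L leb01 (\<lambda>x. f x * cnj (g x))"
proof -
  fix f f' g g' assume "L2_rel f f'" "L2_rel g g'"
  then have *: "square_integrable01 f" "square_integrable01 f'"
      "square_integrable01 g" "square_integrable01 g'"
      "AE x in leb01. f x = f' x" "AE x in leb01. g x = g' x"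
    by (auto simp: L2_rel_def)
  show "integral\<^sup>L leb01 (\<lambda>x. f x * cnj (g x)) = integral\<^sup>L leb01 (\<lambda>x. f' x * cnj (g' x))"
    by (rule integral_cong_AE)
       (use * in \<open>auto intro!: borel_measurable_integrable square_integrable01_mult\<close>)
qed

definition uminus_L2 :: "L2 \<Rightarrow> L2" where "uminus_L2 f = scaleC (-1) f"
definition minus_L2 :: "L2 \<Rightarrow> L2 \<Rightarrow> L2" where "minus_L2 f g = f + (- g)"
definition scaleR_L2 :: "real \<Rightarrow> L2 \<Rightarrow> L2" where "scaleR_L2 r f = scaleC (complex_of_real r) f"
definition inner_L2 :: "L2 \<Rightarrow> L2 \<Rightarrow> real" where "inner_L2 f g = Re (cinner f g)"
definition norm_L2 :: "L2 \<Rightarrow> real" where "norm_L2 f = sqrt (inner f f)"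
definition dist_L2 :: "L2 \<Rightarrow> L2 \<Rightarrow> real" where "dist_L2 f g = norm (f - g)"
definition sgn_L2 :: "L2 \<Rightarrow> L2" where "sgn_L2 f = scaleR (inverse (norm f)) f"
definition uniformity_L2 :: "(L2 \<times> L2) filter" where
  "uniformity_L2 = (INF e\<in>{0<..}. principal {(f, g). dist f g < e})"
definition open_L2 :: "L2 set \<Rightarrow> bool" where
  "open_L2 U \<longleftrightarrow> (\<forall>f\<in>U. eventually (\<lambda>(f', g). f' = f \<longrightarrow> g \<in> U) uniformity)"

instance
proof
  fix f g h :: L2 and c d :: complex and r s :: real and U :: "L2 set"
  have scaleC_one: "scaleC 1 k = k" for k :: L2
    by transfer (simp add: L2_rel_def)
  have zero: "scaleC 0 k = 0" for k :: L2
    by transfer (simp add: L2_rel_def square_integrable01_zero)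
  show scal_r: "c *\<^sub>C (f + g) = c *\<^sub>C f + c *\<^sub>C g" for c and f g :: L2
    by transfer (auto simp: L2_rel_def distrib_left
        intro!: square_integrable01_add square_integrable01_scale)
  show scal_l: "(c + d) *\<^sub>C f = c *\<^sub>C f + d *\<^sub>C f" for c d and f :: L2
    by transfer (auto simp: L2_rel_def distrib_right[symmetric]
        intro!: square_integrable01_add square_integrable01_scale)
  show scal_s: "c *\<^sub>C (d *\<^sub>C f) = (c * d) *\<^sub>C f" for c d and f :: L2
    by transfer (auto simp: L2_rel_def mult.assoc[symmetric] intro!: square_integrable01_scale)
  show "r *\<^sub>R f = complex_of_real r *\<^sub>C f"
    by (rule scaleR_L2_def)
  show "f + g + h = f + (g + h)"
    by transfer (auto simp: L2_rel_def add.assoc intro!: square_integrable01_add)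
  show "f + g = g + f"
    by transfer (auto simp: L2_rel_def add.commute intro!: square_integrable01_add)
  show "0 + f = f"
    by transfer (auto simp: L2_rel_def)
  show "- f + f = 0"
    using scal_l[of "-1" 1 f] by (simp add: uminus_L2_def scaleC_one zero)
  show "f - g = f + (- g)"
    by (rule minus_L2_def)
  show "r *\<^sub>R (f + g) = r *\<^sub>R f + r *\<^sub>R g" "(r + s) *\<^sub>R f = r *\<^sub>R f + s *\<^sub>R f"
    "r *\<^sub>R s *\<^sub>R f = (r * s) *\<^sub>R f" "1 *\<^sub>R f = f"
    by (simp_all add: scaleR_L2_def scal_r scal_l scal_s scaleC_one)
  show com: "cinner f g = cnj (cinner g f)" for f g :: L2
    by transfer (simp flip: Bochner_Integration.integral_cnj add: mult.commute)
  show add: "cinner (f + g) h = cinner f h + cinner g h" for f g h :: L2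
    by transfer (auto simp: L2_rel_def distrib_right
        intro!: Bochner_Integration.integral_add square_integrable01_mult)
  show scal: "cinner (c *\<^sub>C f) g = c * cinner f g" for c and f g :: L2
    by transfer (simp add: mult.assoc)
  show "inner f g = Re (cinner f g)"
    by (rule inner_L2_def)
  show "inner f g = inner g f"
    unfolding inner_L2_def by (subst com) simp
  show "inner (f + g) h = inner f h + inner g h"
    by (simp add: inner_L2_def add)
  show "inner (r *\<^sub>R f) g = r * inner f g"
    by (simp add: inner_L2_def scaleR_L2_def scal)
  have eq: "integral\<^sup>L leb01 (\<lambda>x. k x * cnj (k x))
      = complex_of_real (integral\<^sup>L leb01 (\<lambda>x. (norm (k x))\<^sup>2))" for k
    by (simp only: complex_norm_square integral_complex_of_real[symmetric])
  show "0 \<le> inner f f"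
    unfolding inner_L2_def by transfer (simp add: eq)
  show "inner f f = 0 \<longleftrightarrow> f = 0"
    unfolding inner_L2_def
  proof transfer
    fix f assume "L2_rel f f"
    then have "square_integrable01 f"
      by (simp add: L2_rel_def)
    then have "integral\<^sup>L leb01 (\<lambda>x. (norm (f x))\<^sup>2) = 0 \<longleftrightarrow> (AE x in leb01. f x = 0)"
      by (subst integral_nonneg_eq_0_iff_AE) (auto simp: square_integrable01_def)
    then show "Re (integral\<^sup>L leb01 (\<lambda>x. f x * cnj (f x))) = 0 \<longleftrightarrow> L2_rel f (\<lambda>_. 0)"
      using \<open>square_integrable01 f\<close> square_integrable01_zero by (simp add: eq L2_rel_def)
  qed
  show "norm f = sqrt (inner f f)"
    by (rule norm_L2_def)
  show "dist f g = norm (f - g)"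
    by (rule dist_L2_def)
  show "sgn f = inverse (norm f) *\<^sub>R f"
    by (rule sgn_L2_def)
  show "(uniformity :: (L2 \<times> L2) filter) = (INF e\<in>{0<..}. principal {(f, g). dist f g < e})"
    by (rule uniformity_L2_def)
  show "open U \<longleftrightarrow> (\<forall>f\<in>U. eventually (\<lambda>(f', g). f' = f \<longrightarrow> g \<in> U) uniformity)"
    by (rule open_L2_def)
qed

end


section \<open>The Volterra operator\<close>

text \<open>
  On representatives; only the values at \<open>x \<in> {0..1}\<close> matter for the class in \<^typ>\<open>L2\<close>.
\<close>

definition volterra_fun :: "(real \<Rightarrow> complex) \<Rightarrow> real \<Rightarrow> complex" where
  "volterra_fun f x = integral\<^sup>L (lebesgue_on {0..x}) f"

lemma continuous_on_volterra_fun: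
  assumes "integrable leb01 f"
  shows "continuous_on {0..1} (volterra_fun f)"
  unfolding volterra_fun_def using assms by (rule indefinite_integral_continuous_real)

lemma square_integrable01_continuous:
  assumes "continuous_on {0..1} f"
  shows "square_integrable01 f"
  unfolding square_integrable01_def
proof
  show "f \<in> borel_measurable leb01"
    using assms by (intro continuous_imp_measurable_on_sets_lebesgue) auto
  show "integrable leb01 (\<lambda>x. (norm (f x))\<^sup>2)"
    using assms by (intro continuous_imp_integrable_real continuous_intros)
qed

lift_definition volterra :: "L2 \<Rightarrow> L2" is volterra_fun
proof -
  fix f g assume "L2_rel f g"
  then have sq: "square_integrable01 f" "square_integrable01 g"
    and AE: "AE x in leb01. f x = g x"
    by (auto simp: L2_rel_def)
  note int = sq[THEN square_integrable01_integrable]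
  have "volterra_fun f x = volterra_fun g x" if "x \<in> {0..1}" for x
    unfolding volterra_fun_def
  proof (rule integral_cong_AE)
    show "f \<in> borel_measurable (lebesgue_on {0..x})" "g \<in> borel_measurable (lebesgue_on {0..x})"
      using int that by (auto intro!: borel_measurable_integrable integrable_subinterval[of 0 1])
    show "AE t in lebesgue_on {0..x}. f t = g t"
      using AE that by (auto simp: AE_restrict_space_iff)
  qed
  then have "AE x in leb01. volterra_fun f x = volterra_fun g x"
    by (intro AE_I2) simp
  then show "L2_rel (volterra_fun f) (volterra_fun g)"
    using int by (auto simp: L2_rel_def
        intro!: square_integrable01_continuous continuous_on_volterra_fun)
qed

lemma volterra_fun_eq_0_imp_AE:
  assumes f: "integrable leb01 f" and V: "AE x in leb01. volterra_fun f x = 0"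
  shows "AE x in leb01. f x = 0"
proof -
  have cont: "continuous_on {0..1} (\<lambda>x. (norm (volterra_fun f x))\<^sup>2)"
    by (intro continuous_intros continuous_on_volterra_fun f)
  have "integral\<^sup>L leb01 (\<lambda>x. (norm (volterra_fun f x))\<^sup>2) = 0"
    by (rule integral_eq_zero_AE) (use V in \<open>auto\<close>)
  then have V0: "volterra_fun f x = 0" if "x \<in> {0..1}" for x
    using integralL_eq_0_iff[OF cont] that by simp
  define h where "h x = indicator {0..1} x *\<^sub>R f x" for x :: real
  have h: "integrable lebesgue h"
    using f unfolding h_def by (subst (asm) integrable_restrict_space) auto
  have h_set: "set_integrable lebesgue A h" if "A \<in> sets lebesgue" for A
    unfolding set_integrable_def by (rule integrable_mult_indicator[OF that h])
  have h_atMost: "(LINT x:{..a}|lebesgue. h x) = 0" for a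
  proof (cases "a < 0")
    case True
    then have "indicator {..a} x *\<^sub>R h x = 0" for x
      by (auto simp: h_def indicator_def)
    then show ?thesis
      by (simp only: set_lebesgue_integral_def Bochner_Integration.integral_zero)
  next
    case False
    have "indicator {..a} x *\<^sub>R h x = indicator {0..min a 1} x *\<^sub>R f x" for x
      by (auto simp: h_def indicator_def)
    then have "(LINT x:{..a}|lebesgue. h x) = volterra_fun f (min a 1)"
      unfolding set_lebesgue_integral_def volterra_fun_def
      by (subst integral_restrict_space) auto
    then show ?thesis
      using V0[of "min a 1"] False by simp
  qed
  have h_total: "integral\<^sup>L lebesgue h = 0"
  proof -
    have "indicator {..1} x *\<^sub>R h x = h x" for x :: real
      by (auto simp: h_def indicator_def)
    then show ?thesis
      using h_atMost[of 1] by (simp only: set_lebesgue_integral_def)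
  qed
  have h_borel: "(LINT x:A|lebesgue. h x) = 0" if "A \<in> sets borel" for A
  proof -
    let ?G = "range (\<lambda>a::real. {..a})"
    have borel: "sigma_sets UNIV ?G = sets borel"
      by (simp add: borel_eq_atMost)
    have leb: "B \<in> sets lebesgue" if "B \<in> sigma_sets UNIV ?G" for B
      using that unfolding borel by simp
    have "Int_stable ?G"
      by (auto simp: Int_stable_def)
    moreover have "?G \<subseteq> Pow UNIV" "A \<in> sigma_sets UNIV ?G"
      using that borel by auto
    ultimately show ?thesis
    proof (induction rule: sigma_sets_induct_disjoint)
      case (basic B)
      then show ?case
        using h_atMost by auto
    next
      case empty
      show ?case
        by (simp add: set_lebesgue_integral_def)
    next
      case (compl B)
      have "(LINT x:B \<union> (UNIV - B)|lebesgue. h x) =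
          (LINT x:B|lebesgue. h x) + (LINT x:UNIV - B|lebesgue. h x)"
        using leb[OF compl(1)] by (intro set_integral_Un h_set) auto
      then show ?case
        using compl h_total by (simp add: set_lebesgue_integral_def)
    next
      case (union B)
      have leb_B: "B i \<in> sets lebesgue" for i
        using union leb by auto
      have "(LINT x:(\<Union>i. B i)|lebesgue. h x) = (\<Sum>i. (LINT x:(B i)|lebesgue. h x))"
        using union(1) leb_B
        by (intro lebesgue_integral_countable_add h_set) (auto simp: disjoint_family_on_def)
      then show ?case
        using union by simp
    qed
  qed
  interpret leb01: finite_measure leb01
    by (rule finite_measure_lebesgue_on) simp
  show ?thesis
  proof (rule leb01.density_zero[OF f])
    fix A assume "A \<in> sets leb01"
    then have "A \<in> sets lebesgue" "A \<subseteq> {0..1}"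
      by (auto simp: sets_restrict_space)
    from this(1) obtain S N N' where A: "A = S \<union> N" "N \<subseteq> N'" "N' \<in> null_sets lborel" "S \<in> sets lborel"
      by (rule sets_completionE)
    have N': "N' \<in> null_sets lebesgue"
      using A(3) by (rule null_sets_completionI)
    have "(LINT x:A|lebesgue. h x) = (LINT x:S|lebesgue. h x)"
      unfolding set_lebesgue_integral_def
    proof (rule integral_cong_AE)
      show "(\<lambda>x. indicator A x *\<^sub>R h x) \<in> borel_measurable lebesgue"
        using h_set[OF \<open>A \<in> sets lebesgue\<close>] by (auto simp: set_integrable_def)
      show "(\<lambda>x. indicator S x *\<^sub>R h x) \<in> borel_measurable lebesgue"
        using h_set[of S] A(4) by (auto simp: set_integrable_def)
      show "AE x in lebesgue. indicator A x *\<^sub>R h x = indicator S x *\<^sub>R h x"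
        using AE_not_in[OF N'] by eventually_elim (use A in \<open>auto simp: indicator_def\<close>)
    qed
    also have "\<dots> = 0"
      using h_borel A(4) by simp
    finally have "integral\<^sup>L lebesgue (\<lambda>x. indicator {0..1} x *\<^sub>R indicator A x *\<^sub>R f x) = 0"
      unfolding set_lebesgue_integral_def h_def by (simp only: scaleR_left_commute)
    moreover have "{0..1::real} \<inter> space lebesgue \<in> sets lebesgue"
      by simp
    ultimately show "(LINT x:A|leb01. f x) = 0"
      unfolding set_lebesgue_integral_def by (simp only: integral_restrict_space)
  qed
qed

text \<open>
  By injectivity, \<open>inv volterra\<close> on the domain \<open>range volterra\<close> is the inverse operator of
  \<open>volterra\<close>.
\<close>

lemma inj_volterra: "inj volterra"
proof (rule injI)
  show "f = g" if "volterra f = volterra g" for f g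
    using that
  proof transfer
    fix f g assume "L2_rel f f" "L2_rel g g" and V: "L2_rel (volterra_fun f) (volterra_fun g)"
    then have sq: "square_integrable01 f" "square_integrable01 g"
      by (auto simp: L2_rel_def)
    note int = sq[THEN square_integrable01_integrable]
    have diff: "volterra_fun (\<lambda>t. f t - g t) x = volterra_fun f x - volterra_fun g x"
      if "x \<in> {0..1}" for x
      unfolding volterra_fun_def
      using that int by (intro Bochner_Integration.integral_diff) (auto intro: integrable_subinterval[of 0 1])
    have "AE x in leb01. volterra_fun f x = volterra_fun g x"
      using V by (simp add: L2_rel_def)
    then have "AE x in leb01. volterra_fun (\<lambda>t. f t - g t) x = 0"
      by (rule lebesgue_on_mono) (simp add: diff)
    then have "AE x in leb01. f x - g x = 0"
      by (rule volterra_fun_eq_0_imp_AE[rotated]) (use int in simp)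
    then show "L2_rel f g"
      using sq by (simp add: L2_rel_def)
  qed
qed

end

theory Submission
  imports Defs
begin

text \<open>
  Write \<open>u = V f\<close>, so that the numbers in question are \<open>\<langle>f, V f\<rangle> = \<integral> u' u*\<close> (with \<open>*\<close> for the
  conjugate) over the absolutely continuous \<open>u\<close> with \<open>u 0 = 0\<close>, \<open>u' \<in> L\<^sup>2\<close> and \<open>\<parallel>u\<parallel> = 1\<close>.
  Since \<open>2 Re (u' u*) = (\<bar>u\<bar>\<^sup>2)'\<close>, the real part of such a number is \<open>\<bar>u 1\<bar>\<^sup>2 / 2\<close>, which is
  nonnegative. In \<open>Re_integral_mult_primitive\<close> this is obtained from Fubini's theorem
  instead of the product rule, because \<open>u\<close> is differentiable only almost everywhere.

  Conversely, the real and the imaginary part can be prescribed independently. Let \<open>\<phi>\<close> be real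
  and continuously differentiable with \<open>\<phi> 0 = 0\<close> and \<open>\<parallel>\<phi>\<parallel> = 1\<close>, and take \<open>u x = \<phi> x e\<^bsup>i\<lambda>x\<^esup>\<close>. Then
  \<open>u' u* = \<phi>' \<phi> + i \<lambda> \<phi>\<^sup>2\<close>, so that \<open>\<langle>f, V f\<rangle> = (\<phi> 1)\<^sup>2 / 2 + i \<lambda>\<close>
  (\<open>modulation_in_numerical_range\<close>). The boundary value \<open>\<phi> 1 \<ge> 0\<close> is arbitrary
  (\<open>normalized_function_with_boundary_value\<close>): a high power of \<open>x\<close>
  reaches it with norm at most 1, and adding a multiple of the bump \<open>x (1 - x)\<close> makes the norm
  exactly 1 without changing the endpoints.
\<close>

section \<open>The numerical range lies in the right half-plane\<close>

lemma volterra_fun_eq_indicator: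
  assumes "s \<in> {0..1}"
  shows "volterra_fun f s = (LINT t|leb01. indicator {..s} t *\<^sub>R f t)"
proof -
  have "volterra_fun f s = (LINT t|lebesgue. indicator {0..s} t *\<^sub>R f t)"
    unfolding volterra_fun_def by (subst integral_restrict_space) auto
  also have "(\<lambda>t. indicator {0..s} t *\<^sub>R f t)
      = (\<lambda>t. indicator {0..1} t *\<^sub>R (indicator {..s} t *\<^sub>R f t))"
    using assms by (auto simp: indicator_def)
  also have "(LINT t|lebesgue. indicator {0..1} t *\<^sub>R (indicator {..s} t *\<^sub>R f t))
      = (LINT t|leb01. indicator {..s} t *\<^sub>R f t)"
    by (subst integral_restrict_space) auto
  finally show ?thesis .
qed

text \<open>
  Complementary half-lines overlap in the point \<open>t\<close>, which is a null set.
\<close>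

lemma integral_atLeast_eq_diff_volterra_fun:
  assumes f: "integrable leb01 f" and t: "t \<in> {0..1}"
  shows "(LINT s|leb01. indicator {t..} s *\<^sub>R f s) = volterra_fun f 1 - volterra_fun f t"
proof -
  have int: "integrable leb01 (\<lambda>s. indicator A s *\<^sub>R f s)" if "A \<in> sets borel" for A
  proof -
    have m: "indicat_real A \<in> borel_measurable leb01"
      using that by (intro measurable_restrict_space1 borel_measurable_indicator) auto
    show ?thesis
    proof (rule Bochner_Integration.integrable_bound[OF f])
      show "(\<lambda>s. indicator A s *\<^sub>R f s) \<in> borel_measurable leb01"
        using m f by (intro borel_measurable_scaleR) auto
    qed (auto simp: indicator_def)
  qed
  have null: "{t} \<in> null_sets leb01"
    using t by (subst null_sets_restrict_space) auto
  have "(LINT s|leb01. indicator {t..} s *\<^sub>R f s)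
      = (LINT s|leb01. f s - indicator {..t} s *\<^sub>R f s)"
  proof (rule integral_cong_AE)
    show "AE s in leb01. indicator {t..} s *\<^sub>R f s = f s - indicator {..t} s *\<^sub>R f s"
      using AE_not_in[OF null] by eventually_elim (auto simp: indicator_def)
  qed (use int[of "{t..}"] int[of "{..t}"] f in auto)
  also have "\<dots> = integral\<^sup>L leb01 f - (LINT s|leb01. indicator {..t} s *\<^sub>R f s)"
    using int[of "{..t}"] f by (intro Bochner_Integration.integral_diff) auto
  finally show ?thesis
    using t by (simp add: volterra_fun_eq_indicator[of t]) (simp add: volterra_fun_def)
qed

text \<open>
  Put \<open>I = \<integral> f (V f)*\<close> and \<open>T = \<integral> f\<close>. Exchanging the order of integration turns the
  integral over the triangle \<open>t \<le> s\<close> that defines \<open>I*\<close> into \<open>\<integral> f (T - V f)* = \<bar>T\<bar>\<^sup>2 - I\<close>.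
\<close>

lemma Re_integral_mult_primitive:
  assumes f: "integrable leb01 f"
  shows "Re (LINT s|leb01. f s * cnj (volterra_fun f s)) = (norm (volterra_fun f 1))\<^sup>2 / 2"
proof -
  let ?T = "volterra_fun f 1"
  define I where "I = (LINT s|leb01. f s * cnj (volterra_fun f s))"
  define P where "P s t = indicat_real {(s, t). t \<le> s} (s, t) *\<^sub>R (cnj (f s) * f t)" for s t
  \<comment> \<open>integrating \<open>P\<close> over \<open>t\<close> first gives \<open>I*\<close>, over \<open>s\<close> first gives \<open>\<bar>T\<bar>\<^sup>2 - I\<close>\<close>
  interpret leb01: finite_measure leb01
    by (rule finite_measure_lebesgue_on) simp
  interpret pair: pair_sigma_finite leb01 leb01 ..
  have [measurable]: "f \<in> borel_measurable leb01"
    using f by auto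
  have [measurable]: "(\<lambda>s. cnj (f s)) \<in> borel_measurable leb01"
    using f by (intro borel_measurable_integrable integrable_cnj)
  have id: "(\<lambda>x. x) \<in> borel_measurable leb01"
    by (intro continuous_imp_measurable_on_sets_lebesgue continuous_intros) auto
  have [measurable]: "fst \<in> borel_measurable (leb01 \<Otimes>\<^sub>M leb01)"
      "snd \<in> borel_measurable (leb01 \<Otimes>\<^sub>M leb01)"
    using measurable_compose[OF measurable_fst id] measurable_compose[OF measurable_snd id] by auto
  have tri: "{p \<in> space (leb01 \<Otimes>\<^sub>M leb01). snd p \<le> fst p} \<in> sets (leb01 \<Otimes>\<^sub>M leb01)"
    by measurable
  have "integrable (leb01 \<Otimes>\<^sub>M leb01) (\<lambda>p. cnj (f (fst p)) * f (snd p))"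
    using f by (intro pair.Fubini_integrable) (auto simp: norm_mult)
  from integrable_mult_indicator[OF tri this]
  have "integrable (leb01 \<Otimes>\<^sub>M leb01) (case_prod P)"
    by (rule Bochner_Integration.integrable_cong[THEN iffD1, rotated -1])
       (auto simp: P_def indicator_def)
  from pair.Fubini_integral[OF this]
  have swap: "(LINT t|leb01. LINT s|leb01. P s t) = (LINT s|leb01. LINT t|leb01. P s t)" .
  have "(LINT s|leb01. LINT t|leb01. P s t) = (LINT s|leb01. cnj (f s * cnj (volterra_fun f s)))"
  proof (rule Bochner_Integration.integral_cong[OF refl])
    fix s assume "s \<in> space leb01"
    have "P s = (\<lambda>t. cnj (f s) * (indicator {..s} t *\<^sub>R f t))"
      by (auto simp: P_def indicator_def)
    with \<open>s \<in> space leb01\<close> show "(LINT t|leb01. P s t) = cnj (f s * cnj (volterra_fun f s))"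
      by (simp only: integral_mult_right_zero volterra_fun_eq_indicator space_lebesgue_on
            complex_cnj_mult complex_cnj_cnj)
  qed
  also have "\<dots> = cnj I"
    by (simp only: I_def Bochner_Integration.integral_cnj)
  finally have left: "(LINT s|leb01. LINT t|leb01. P s t) = cnj I" .
  have "(LINT t|leb01. LINT s|leb01. P s t)
      = (LINT t|leb01. f t * cnj ?T - f t * cnj (volterra_fun f t))"
  proof (rule Bochner_Integration.integral_cong[OF refl])
    fix t assume "t \<in> space leb01"
    then have t: "t \<in> {0..1}" by simp
    have "(\<lambda>s. P s t) = (\<lambda>s. f t * cnj (indicator {t..} s *\<^sub>R f s))"
      by (auto simp: P_def indicator_def)
    then have "(LINT s|leb01. P s t) = f t * cnj (LINT s|leb01. indicator {t..} s *\<^sub>R f s)"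
      by (simp only: integral_mult_right_zero Bochner_Integration.integral_cnj)
    also have "\<dots> = f t * cnj ?T - f t * cnj (volterra_fun f t)"
      by (simp add: integral_atLeast_eq_diff_volterra_fun[OF f t] algebra_simps)
    finally show "(LINT s|leb01. P s t) = f t * cnj ?T - f t * cnj (volterra_fun f t)" .
  qed
  also have "\<dots> = (LINT t|leb01. f t * cnj ?T) - I"
    unfolding I_def
  proof (rule Bochner_Integration.integral_diff)
    have bnd: "bounded (volterra_fun f ` {0..1})"
      by (intro compact_imp_bounded compact_continuous_image continuous_on_volterra_fun f) auto
    then obtain K where K: "\<And>x. x \<in> {0..1} \<Longrightarrow> norm (volterra_fun f x) \<le> K"
      unfolding bounded_iff by blast
    have m: "(\<lambda>t. cnj (volterra_fun f t)) \<in> borel_measurable leb01"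
      by (intro continuous_imp_measurable_on_sets_lebesgue continuous_intros
            continuous_on_volterra_fun f) auto
    show "integrable leb01 (\<lambda>t. f t * cnj (volterra_fun f t))"
    proof (rule Bochner_Integration.integrable_bound)
      show "integrable leb01 (\<lambda>t. K * norm (f t))"
        using f by auto
      show "AE t in leb01. norm (f t * cnj (volterra_fun f t)) \<le> norm (K * norm (f t))"
      proof (rule AE_I2)
        fix t assume "t \<in> space leb01"
        then have "norm (volterra_fun f t) \<le> K" using K by simp
        then have "norm (volterra_fun f t) * norm (f t) \<le> \<bar>K\<bar> * norm (f t)"
          by (intro mult_right_mono) auto
        then show "norm (f t * cnj (volterra_fun f t)) \<le> norm (K * norm (f t))"
          by (simp add: norm_mult abs_mult mult.commute)
      qed
    qed (use m in measurable)
  qed (use f in auto)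
  also have "(LINT t|leb01. f t * cnj ?T) = ?T * cnj ?T"
    by (simp add: volterra_fun_def)
  finally have "cnj I = ?T * cnj ?T - I"
    using left swap by simp
  then have "I + cnj I = complex_of_real ((norm ?T)\<^sup>2)"
    by (simp only: complex_norm_square) (simp add: algebra_simps)
  then have "2 * Re I = (norm ?T)\<^sup>2"
    by (simp only: complex_add_cnj of_real_eq_iff)
  then show ?thesis
    by (simp add: I_def)
qed

lemma Re_cinner_volterra_nonneg: "0 \<le> Re (cinner f (volterra f))"
proof transfer
  fix f assume "L2_rel f f"
  then have "integrable leb01 f"
    by (simp add: L2_rel_def square_integrable01_integrable)
  then show "0 \<le> Re (LINT x|leb01. f x * cnj (volterra_fun f x))"
    by (simp add: Re_integral_mult_primitive)
qed


section \<open>Smooth functions that attain every value\<close>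

lemma integral_lebesgue_on_FTC:
  fixes F f :: "real \<Rightarrow> 'a::euclidean_space"
  assumes "a \<le> b" and "continuous_on {a..b} f"
    and "\<And>x. x \<in> {a..b} \<Longrightarrow> (F has_vector_derivative f x) (at x within {a..b})"
  shows "integral\<^sup>L (lebesgue_on {a..b}) f = F b - F a"
proof -
  have "integral\<^sup>L (lebesgue_on {a..b}) f = integral {a..b} f"
    using assms by (intro lebesgue_integral_eq_integral continuous_imp_integrable_real) auto
  also have "\<dots> = F b - F a"
    using fundamental_theorem_of_calculus[OF assms(1,3)] by (rule integral_unique)
  finally show ?thesis .
qed

lemma numerical_range_inv_volterraI:
  assumes "norm (volterra f) = 1"
  shows "cinner f (volterra f) \<in> numerical_range (range volterra) (inv volterra)"
  unfolding numerical_range_def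
  using assms by (auto simp: inv_f_f[OF inj_volterra] intro!: exI[of _ "volterra f"])

text \<open>
  The phase \<open>e\<^bsup>i\<lambda>x\<^esup>\<close> leaves \<open>\<bar>u\<bar>\<close> unchanged and adds \<open>i \<lambda> \<bar>u\<bar>\<^sup>2\<close> to \<open>u' u*\<close>, so it shifts
  the value by \<open>i \<lambda>\<close>.
\<close>

lemma modulation_in_numerical_range:
  fixes \<phi> \<phi>' :: "real \<Rightarrow> real"
  assumes deriv: "\<And>x. (\<phi> has_real_derivative \<phi>' x) (at x)"
    and cont': "continuous_on UNIV \<phi>'"
    and zero: "\<phi> 0 = 0"
    and norm1: "integral\<^sup>L leb01 (\<lambda>x. (\<phi> x)\<^sup>2) = 1"
  shows "Complex ((\<phi> 1)\<^sup>2 / 2) l \<in> numerical_range (range volterra) (inv volterra)"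
proof -
  define e where "e x = exp (\<i> * of_real (l * x))" for x :: real
  define u where "u x = of_real (\<phi> x) * e x" for x
  define f where "f x = (of_real (\<phi>' x) + \<i> * of_real l * of_real (\<phi> x)) * e x" for x
  have cont: "continuous_on S \<phi>" "continuous_on S \<phi>'" for S
    using deriv cont' by (auto intro: DERIV_atLeastAtMost_imp_continuous_on
        continuous_on_subset continuous_at_imp_continuous_on DERIV_isCont)
  have cont_e: "continuous_on S e" for S
    unfolding e_def by (intro continuous_intros)
  have cont_f: "continuous_on S f" for S
    unfolding f_def by (intro continuous_intros cont cont_e)
  have e_cnj: "e x * cnj (e x) = 1" for x
    by (simp add: e_def exp_cnj flip: exp_add)
  have der_u: "(u has_vector_derivative f x) (at x within S)" for x S
  proof -
    have e: "(e has_vector_derivative (\<i> * of_real l) * e x) (at x)"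
    proof -
      have "((\<lambda>z. exp (\<i> * (of_real l * z))) has_field_derivative (\<i> * of_real l) * e x)
          (at (of_real x))"
        by (auto intro!: derivative_eq_intros simp: e_def)
      from has_vector_derivative_real_field[OF this]
      show ?thesis by (simp add: e_def[abs_def] o_def)
    qed
    have p: "((\<lambda>x. complex_of_real (\<phi> x)) has_vector_derivative of_real (\<phi>' x)) (at x)"
      by (intro has_vector_derivative_of_real deriv)
    have "(u has_vector_derivative f x) (at x)"
      unfolding u_def f_def
      by (rule has_vector_derivative_eq_rhs[OF has_vector_derivative_mult[OF p e]])
         (simp add: algebra_simps)
    then show ?thesis
      by (rule has_vector_derivative_at_within)
  qed
  have Vf: "volterra_fun f x = u x" if "x \<in> {0..1}" for x
  proof -
    have "volterra_fun f x = u x - u 0"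
      unfolding volterra_fun_def
      using that by (intro integral_lebesgue_on_FTC cont_f der_u) auto
    then show ?thesis
      by (simp add: u_def zero)
  qed
  have sq: "L2_rel f f"
    by (simp add: L2_rel_def square_integrable01_continuous cont_f)
  have "L2_rel (volterra_fun f) (volterra_fun f)"
    using sq by (auto simp: L2_rel_def intro!: square_integrable01_continuous
        continuous_on_volterra_fun square_integrable01_integrable)
  note abs = volterra.abs_eq[OF sq] cinner_L2.abs_eq[OF sq this] cinner_L2.abs_eq[OF this this]
  have "cinner (volterra (abs_L2 f)) (volterra (abs_L2 f))
      = (LINT x|leb01. complex_of_real ((\<phi> x)\<^sup>2))"
  proof (unfold abs, rule Bochner_Integration.integral_cong[OF refl])
    fix x assume "x \<in> space leb01"
    then show "volterra_fun f x * cnj (volterra_fun f x) = complex_of_real ((\<phi> x)\<^sup>2)"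
      using e_cnj[of x] by (simp add: Vf u_def power2_eq_square)
  qed
  then have "cinner (volterra (abs_L2 f)) (volterra (abs_L2 f)) = 1"
    by (simp only: integral_complex_of_real norm1 of_real_1)
  then have "norm (volterra (abs_L2 f)) = 1"
    by (simp add: norm_L2_def inner_L2_def)
  moreover have "cinner (abs_L2 f) (volterra (abs_L2 f)) = Complex ((\<phi> 1)\<^sup>2 / 2) l"
  proof -
    have "cinner (abs_L2 f) (volterra (abs_L2 f))
        = (LINT x|leb01. complex_of_real (\<phi> x * \<phi>' x) + \<i> * of_real l * complex_of_real ((\<phi> x)\<^sup>2))"
    proof (unfold abs, rule Bochner_Integration.integral_cong[OF refl])
      fix x assume "x \<in> space leb01"
      then have "f x * cnj (volterra_fun f x)
          = (of_real (\<phi>' x) + \<i> * of_real l * of_real (\<phi> x)) * of_real (\<phi> x) * (e x * cnj (e x))"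
        by (simp add: Vf u_def f_def)
      then show "f x * cnj (volterra_fun f x)
          = complex_of_real (\<phi> x * \<phi>' x) + \<i> * of_real l * complex_of_real ((\<phi> x)\<^sup>2)"
        by (simp add: e_cnj power2_eq_square algebra_simps)
    qed
    also have "\<dots> = (LINT x|leb01. complex_of_real (\<phi> x * \<phi>' x))
        + (LINT x|leb01. \<i> * of_real l * complex_of_real ((\<phi> x)\<^sup>2))"
      by (intro Bochner_Integration.integral_add continuous_imp_integrable_real
            continuous_intros cont)
    also have "\<dots> = complex_of_real (LINT x|leb01. \<phi> x * \<phi>' x) + \<i> * of_real l"
      by (simp only: integral_mult_right_zero integral_complex_of_real norm1) simp
    also have "(LINT x|leb01. \<phi> x * \<phi>' x) = (\<phi> 1)\<^sup>2 / 2 - (\<phi> 0)\<^sup>2 / 2"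
    proof (rule integral_lebesgue_on_FTC[where F = "\<lambda>x. (\<phi> x)\<^sup>2 / 2"])
      fix x :: real
      have "((\<lambda>x. (\<phi> x)\<^sup>2 / 2) has_real_derivative \<phi> x * \<phi>' x) (at x)"
        by (auto intro!: derivative_eq_intros deriv)
      then show "((\<lambda>x. (\<phi> x)\<^sup>2 / 2) has_vector_derivative \<phi> x * \<phi>' x) (at x within {0..1})"
        by (simp add: has_real_derivative_iff_has_vector_derivative has_vector_derivative_at_within)
    qed (auto intro!: continuous_intros cont)
    finally show ?thesis
      by (simp add: zero complex_eq_iff)
  qed
  ultimately show ?thesis
    using numerical_range_inv_volterraI by metis
qed

text \<open>
  The function is \<open>c x\<^bsup>n+1\<^esup> + b x (1 - x)\<close>. Its squared norm is a quadratic polynomial in \<open>b\<close>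
  with nonnegative coefficients: at \<open>b = 0\<close> it is \<open>c\<^sup>2 / (2 n + 3)\<close>, which is at most 1 for
  large \<open>n\<close>, and since the bump \<open>x (1 - x)\<close> has squared norm \<open>1 / 30\<close>, it is at least 1 once
  \<open>b\<^sup>2 \<ge> 30\<close>.
\<close>

lemma normalized_function_with_boundary_value:
  fixes c :: real
  assumes "0 \<le> c"
  obtains \<phi> \<phi>' :: "real \<Rightarrow> real"
  where "\<And>x. (\<phi> has_real_derivative \<phi>' x) (at x)" "continuous_on UNIV \<phi>'"
    "\<phi> 0 = 0" "\<phi> 1 = c" "integral\<^sup>L leb01 (\<lambda>x. (\<phi> x)\<^sup>2) = 1"
proof -
  obtain n :: nat where n: "c\<^sup>2 \<le> real n"
    using real_arch_simple by blast
  \<comment> \<open>the squared norm as a function of the coefficient of the bump\<close>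
  define J where
    "J b = c\<^sup>2 / (2 * n + 3) + 2 * c * b * (1 / (n + 3) - 1 / (n + 4)) + b\<^sup>2 / 30" for b :: real
  have "\<exists>b. 0 \<le> b \<and> b \<le> 6 \<and> J b = 1"
  proof (rule IVT')
    show "J 0 \<le> 1"
      using n by (simp add: J_def divide_simps)
    have "0 \<le> 2 * c * 6 * (1 / (n + 3) - 1 / (n + 4))"
      using assms by (intro mult_nonneg_nonneg) (auto simp: divide_simps)
    moreover have "0 \<le> c\<^sup>2 / (2 * n + 3)"
      by simp
    moreover have "(1::real) \<le> 6\<^sup>2 / 30"
      by simp
    ultimately show "1 \<le> J 6"
      unfolding J_def by linarith
    show "continuous_on {0..6} J"
      unfolding J_def by (intro continuous_intros) auto
  qed simp
  then obtain b where b: "J b = 1"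
    by blast
  define \<phi> where "\<phi> x = c * x ^ (n + 1) + b * (x * (1 - x))" for x :: real
  define \<phi>' where "\<phi>' x = c * ((n + 1) * x ^ n) + b * (1 - 2 * x)" for x :: real
  \<comment> \<open>\<open>\<Phi>\<close> is the primitive of the expanded square \<open>\<phi>\<^sup>2\<close>, so that \<open>J b = \<Phi> 1 - \<Phi> 0\<close>\<close>
  define P where "P k x = x ^ Suc k / (1 + real k)" for k and x :: real
  define \<Phi> where "\<Phi> x = c\<^sup>2 * P (2 * n + 2) x + 2 * c * b * (P (n + 2) x - P (n + 3) x)
    + b\<^sup>2 * (P 2 x - 2 * P 3 x + P 4 x)" for x
  have P: "(P k has_real_derivative x ^ k) (at x)" for k x
    using DERIV_cdivide[OF DERIV_pow[of "Suc k" x UNIV], of "1 + real k"] by (simp add: P_def[abs_def])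
  have "integral\<^sup>L leb01 (\<lambda>x. (\<phi> x)\<^sup>2) = \<Phi> 1 - \<Phi> 0"
  proof (rule integral_lebesgue_on_FTC)
    fix x :: real
    have "(\<Phi> has_real_derivative c\<^sup>2 * x ^ (2 * n + 2) + 2 * c * b * (x ^ (n + 2) - x ^ (n + 3))
        + b\<^sup>2 * (x\<^sup>2 - 2 * x ^ 3 + x ^ 4)) (at x)"
      unfolding \<Phi>_def[abs_def] by (intro DERIV_add DERIV_diff DERIV_cmult P)
    also have "c\<^sup>2 * x ^ (2 * n + 2) + 2 * c * b * (x ^ (n + 2) - x ^ (n + 3))
        + b\<^sup>2 * (x\<^sup>2 - 2 * x ^ 3 + x ^ 4) = (\<phi> x)\<^sup>2"
    proof -
      define y where "y = x ^ (n + 1)"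
      have y: "x ^ (2 * n + 2) = y * y" "x ^ (n + 2) = y * x" "x ^ (n + 3) = y * x * x"
        by (simp_all add: y_def mult_2 power_add power2_eq_square power3_eq_cube)
      show ?thesis
        unfolding \<phi>_def y y_def[symmetric] by algebra
    qed
    finally show "(\<Phi> has_vector_derivative (\<phi> x)\<^sup>2) (at x within {0..1})"
      by (simp add: has_real_derivative_iff_has_vector_derivative has_vector_derivative_at_within)
  qed (auto simp: \<phi>_def intro!: continuous_intros)
  also have "\<dots> = J b"
    by (simp add: \<Phi>_def J_def P_def power_0_left add.commute)
  finally have "integral\<^sup>L leb01 (\<lambda>x. (\<phi> x)\<^sup>2) = 1"
    using b by simp
  moreover have "(\<phi> has_real_derivative \<phi>' x) (at x)" for x
  proof -
    have "((\<lambda>x. x ^ (n + 1)) has_real_derivative (n + 1) * x ^ n) (at x)"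
      using DERIV_pow[of "n + 1" x UNIV] by simp
    moreover have "((\<lambda>x. x * (1 - x)) has_real_derivative 1 - 2 * x) (at x)"
      by (auto intro!: derivative_eq_intros)
    ultimately show ?thesis
      unfolding \<phi>_def[abs_def] \<phi>'_def by (intro DERIV_add DERIV_cmult)
  qed
  moreover have "continuous_on UNIV \<phi>'"
    unfolding \<phi>'_def by (intro continuous_intros)
  ultimately show thesis
    by (intro that[of \<phi> \<phi>']) (auto simp: \<phi>_def)
qed


section \<open>The numerical range\<close>

theorem theorem1p4:
  shows "numerical_range (range volterra) (inv volterra) = {z. Re z \<ge> 0}"
proof
  show "numerical_range (range volterra) (inv volterra) \<subseteq> {z. Re z \<ge> 0}"
    by (auto simp: numerical_range_def inv_f_f[OF inj_volterra] Re_cinner_volterra_nonneg)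
  show "{z. Re z \<ge> 0} \<subseteq> numerical_range (range volterra) (inv volterra)"
  proof
    fix z assume "z \<in> {z. Re z \<ge> 0}"
    then have z: "0 \<le> Re z" by simp
    obtain \<phi> \<phi>' :: "real \<Rightarrow> real" where \<phi>:
      "\<And>x. (\<phi> has_real_derivative \<phi>' x) (at x)" "continuous_on UNIV \<phi>'"
      "\<phi> 0 = 0" "\<phi> 1 = sqrt (2 * Re z)" "integral\<^sup>L leb01 (\<lambda>x. (\<phi> x)\<^sup>2) = 1"
      using normalized_function_with_boundary_value[of "sqrt (2 * Re z)"] z by auto
    have "Complex ((\<phi> 1)\<^sup>2 / 2) (Im z) \<in> numerical_range (range volterra) (inv volterra)"
      using \<phi>(1-3,5) by (rule modulation_in_numerical_range)
    then show "z \<in> numerical_range (range volterra) (inv volterra)"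
      using z by (simp add: \<phi>(4))
  qed
qed

end
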